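(* Let $(X,d)$ be a compact metric space without isolated points and let $T\colon X\to X$ be a continuous map. Then: (a) If $\mathcal{CI}(X,T)\neq\emptyset$, then $\bigcap_{x\in \mathcal{CI}(X,T)}\omega(x)\neq\emptyset$. (b) If $x,y\in\mathcal{CI}(X,T)$, then $$\#\Big(V_T(y)\setminus\{\mu\in V_T(y)\colon \operatorname{supp}(\mu)\cap\omega(x)\neq\emptyset\}\Big)\le 1.$$ (c) If $x,y\in\mathcal{CI}(X,T)$ and $\mu,\nu\in V_T(y)$, then $$\operatorname{supp}(\mu)\cap(X\setminus\omega(x))=\operatorname{supp}(\nu)\cap(X\setminus\omega(x)).$$ (d) For every $x\in\mathcal{CI}(X,T)$ there exists a $T$-invariant set $\mathbb{B}_x\subseteq\overline{\mathcal{O}_T(x)}$ such that $\mathbb{B}_x$ is Baire generic in $\overline{\mathcal{O}_T(x)}$ and $x\in\mathbb{B}_x\subseteq\mathcal{CI}(X,T)$.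
   Context: $C^0(X,\mathbb{R})$ is the space of continuous real-valued functions on $X$. For $x\in X$, $\mathcal{O}_T(x)=\{T^n(x)\colon n\ge 0\}$ is the orbit of $x$, $\overline{\mathcal{O}_T(x)}$ its closure, and $\omega(x)$ the $\omega$-limit set of $x$, i.e. the set of limits of sequences $T^{n_k}(x)$ with $n_k\to+\infty$. A set $A\subseteq X$ is $T$-invariant if $T(A)\subseteq A$. A subset of a space $Z$ is Baire generic in $Z$ if it contains a countable intersection of open dense subsets of $Z$. For $\varphi\in C^0(X,\mathbb{R})$, $\mathcal{I}(T,\varphi)$ is the set of $x\in X$ such that the sequence $\big(\frac1n\sum_{j=0}^{n-1}\varphi(T^j(x))\big)_{n\ge1}$ does not converge. Let $\mathcal{H}(X,T)=\{\varphi\in C^0(X,\mathbb{R})\colon\mathcal{I}(T,\varphi)\neq\emptyset\}$. The set of completely irregular points is $\mathcal{CI}(X,T)=\bigcap_{\varphi\in\mathcal{H}(X,T)}\mathcal{I}(T,\varphi)$, with the convention that $\mathcal{CI}(X,T)=\emptyset$ if $\mathcal{H}(X,T)=\emptyset$. $V_T(x)$ is the set of accumulation points (limits of subsequences), in the weak$^*$ topology on Borel probability measures of $X$, of the sequence of empirical measures $\frac1n\sum_{j=0}^{n-1}\delta_{T^j(x)}$, $n\ge1$. $\operatorname{supp}(\mu)$ is the support of $\mu$ and $\#$ denotes cardinality. *)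

theory Defs
  imports "HOL-Probability.Probability"
begin

definition orbit :: "('a \<Rightarrow> 'a) \<Rightarrow> 'a \<Rightarrow> 'a set" where
  "orbit T x = {(T ^^ n) x | n. True}"

text \<open>The times \<open>n k\<close> are only required to tend to infinity, not to be increasing.\<close>

definition omega_limit :: "('a::topological_space \<Rightarrow> 'a) \<Rightarrow> 'a \<Rightarrow> 'a set" where
  "omega_limit T x =
    {y. \<exists>n :: nat \<Rightarrow> nat. filterlim n at_top sequentially \<and> (\<lambda>k. (T ^^ n k) x) \<longlonglongrightarrow> y}"

definition invariant_set :: "('a \<Rightarrow> 'a) \<Rightarrow> 'a set \<Rightarrow> bool" where
  "invariant_set T A \<longleftrightarrow> T ` A \<subseteq> A"

definition baire_generic_in :: "'a::topological_space set \<Rightarrow> 'a set \<Rightarrow> bool" where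
  "baire_generic_in A Z \<longleftrightarrow> A \<subseteq> Z \<and>
    (\<exists>U :: nat \<Rightarrow> 'a set.
      (\<forall>n. openin (top_of_set Z) (U n) \<and> (top_of_set Z) closure_of (U n) = Z) \<and>
      (\<Inter>n. U n) \<subseteq> A)"

definition birkhoff_average :: "('a \<Rightarrow> 'a) \<Rightarrow> ('a \<Rightarrow> real) \<Rightarrow> nat \<Rightarrow> 'a \<Rightarrow> real" where
  "birkhoff_average T \<phi> n x = (1 / real n) * (\<Sum>j<n. \<phi> ((T ^^ j) x))"

text \<open>Here and below, \<open>Suc\<close> makes the sequence of averages start at \<open>n = 1\<close>.\<close>

definition irregular_set :: "('a \<Rightarrow> 'a) \<Rightarrow> ('a \<Rightarrow> real) \<Rightarrow> 'a set" where
  "irregular_set T \<phi> = {x. \<not> convergent (\<lambda>n. birkhoff_average T \<phi> (Suc n) x)}"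

definition irregular_observables :: "('a::topological_space \<Rightarrow> 'a) \<Rightarrow> ('a \<Rightarrow> real) set" where
  "irregular_observables T = {\<phi>. continuous_on UNIV \<phi> \<and> irregular_set T \<phi> \<noteq> {}}"

definition completely_irregular :: "('a::topological_space \<Rightarrow> 'a) \<Rightarrow> 'a set" where
  "completely_irregular T =
    (if irregular_observables T = {} then {}
     else (\<Inter>\<phi>\<in>irregular_observables T. irregular_set T \<phi>))"

text \<open>\<open>return borel y\<close> is the Dirac measure at \<open>y\<close>.\<close>

definition empirical_measure :: "('a::topological_space \<Rightarrow> 'a) \<Rightarrow> 'a \<Rightarrow> nat \<Rightarrow> 'a measure" where
  "empirical_measure T x n =
    measure_of UNIV (sets borel)
      (\<lambda>A. (1 / of_nat n) * (\<Sum>j<n. emeasure (return borel ((T ^^ j) x)) A))"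

lemma space_empirical_measure [simp]: "space (empirical_measure T x n) = UNIV"
  by (simp add: empirical_measure_def space_measure_of_conv)

lemma sets_empirical_measure [simp, measurable_cong]:
  "sets (empirical_measure T x n) = sets (borel :: 'a::topological_space measure)"
  using sets.sigma_sets_eq[of "borel :: 'a measure"]
  by (simp add: empirical_measure_def sets_measure_of_conv)

lemma emeasure_empirical_measure:
  fixes T :: "'a::topological_space \<Rightarrow> 'a"
  assumes "A \<in> sets borel"
  shows "emeasure (empirical_measure T x n) A =
    (1 / of_nat n) * (\<Sum>j<n. emeasure (return borel ((T ^^ j) x)) A)"
  unfolding empirical_measure_def
proof (rule emeasure_measure_of_sigma)
  show "sigma_algebra UNIV (sets (borel :: 'a measure))"
    using sets.sigma_algebra_axioms[of "borel :: 'a measure"] by simp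
  show "positive (sets (borel :: 'a measure))
      (\<lambda>A. (1 / of_nat n) * (\<Sum>j<n. emeasure (return borel ((T ^^ j) x)) A))"
    by (simp add: positive_def)
  show "countably_additive (sets (borel :: 'a measure))
      (\<lambda>A. (1 / of_nat n) * (\<Sum>j<n. emeasure (return borel ((T ^^ j) x)) A))"
  proof (rule countably_additiveI)
    fix B :: "nat \<Rightarrow> 'a set"
    assume B: "range B \<subseteq> sets borel" "disjoint_family B" "(\<Union>i. B i) \<in> sets borel"
    have "(\<Sum>i. \<Sum>j<n. emeasure (return borel ((T ^^ j) x)) (B i)) =
        (\<Sum>j<n. \<Sum>i. emeasure (return borel ((T ^^ j) x)) (B i))"
      by (rule suminf_sum) simp
    also have "\<dots> = (\<Sum>j<n. emeasure (return borel ((T ^^ j) x)) (\<Union>i. B i))"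
      using B by (intro sum.cong refl suminf_emeasure) auto
    finally show "(\<Sum>i. (1 / of_nat n) * (\<Sum>j<n. emeasure (return borel ((T ^^ j) x)) (B i))) =
        (1 / of_nat n) * (\<Sum>j<n. emeasure (return borel ((T ^^ j) x)) (\<Union>i. B i))"
      by simp
  qed
qed (fact assms)

lemma prob_space_empirical_measure:
  assumes "n \<ge> 1"
  shows "prob_space (empirical_measure T x n)"
proof
  have "of_nat n / of_nat n = (1 :: ennreal)"
    using assms by (intro ennreal_divide_self) (auto simp: of_nat_less_top)
  then show "emeasure (empirical_measure T x n) (space (empirical_measure T x n)) = 1"
    by (simp add: emeasure_empirical_measure ennreal_divide_times)
qed

definition borel_prob_measures :: "'a::topological_space measure set" where
  "borel_prob_measures = {\<mu>. prob_space \<mu> \<and> sets \<mu> = sets borel}"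

text \<open>
  Meant for compact spaces, where continuous functions are bounded and hence integrable;
  there this is sequential convergence in the weak* topology.
\<close>

definition weak_star_tendsto ::
    "(nat \<Rightarrow> 'a::topological_space measure) \<Rightarrow> 'a measure \<Rightarrow> bool" where
  "weak_star_tendsto M \<mu> \<longleftrightarrow>
    (\<forall>f :: 'a \<Rightarrow> real. continuous_on UNIV f \<longrightarrow>
      (\<lambda>k. integral\<^sup>L (M k) f) \<longlonglongrightarrow> integral\<^sup>L \<mu> f)"

definition limit_measures :: "('a::topological_space \<Rightarrow> 'a) \<Rightarrow> 'a \<Rightarrow> 'a measure set" where
  "limit_measures T x =
    {\<mu> \<in> borel_prob_measures. \<exists>r :: nat \<Rightarrow> nat. strict_mono r \<and>
      weak_star_tendsto (\<lambda>k. empirical_measure T x (Suc (r k))) \<mu>}"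

definition measure_support :: "'a::topological_space measure \<Rightarrow> 'a set" where
  "measure_support \<mu> = {x. \<forall>U. open U \<and> x \<in> U \<longrightarrow> emeasure \<mu> U > 0}"

end

theory Submission
  imports Defs
begin

text \<open>
  Everything rests on one observation about a completely irregular point \<open>x\<close>. If a continuous
  observable \<open>\<phi>\<close> vanishes on \<open>\<omega>(x)\<close>, then \<open>\<phi>\<close> tends to zero along the orbit of \<open>x\<close>, hence so
  do its averages, so \<open>x\<close> is not irregular for \<open>\<phi>\<close>. By complete irregularity no point whatsoever
  is irregular for \<open>\<phi>\<close>: its averages converge everywhere (\<open>averages_converge_of_vanishing\<close>).

  If finitely many of the sets \<open>\<omega>(x)\<close> had empty intersection, a partition of unity subordinate to
  their complements would write any observable as a finite sum of observables, each vanishing on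
  one of the \<open>\<omega>(x)\<close>; then all averages would converge, although a completely irregular point
  exists. By compactness all the sets \<open>\<omega>(x)\<close> have a common point, which is (a).

  Since the averages at \<open>y\<close> of an observable vanishing on \<open>\<omega>(x)\<close> converge, all measures in
  \<open>V\<^sub>T(y)\<close> give it the same integral. Hence they agree on all open sets disjoint from \<open>\<omega>(x)\<close>
  (\<open>limit_measures_agree_off_omega_limit\<close>), which gives (c). A measure whose support misses
  \<open>\<omega>(x)\<close> gives mass zero to \<open>\<omega>(x)\<close> and is thus determined by these values, which gives (b).

  For (d), take all completely irregular points in the orbit closure of \<open>x\<close>. For one
  observable, that the averages at \<open>z\<close> oscillate by more than \<open>q\<close> infinitely often is a \<open>G\<^sub>\<delta>\<close>
  condition on \<open>z\<close>. It holds along the entire orbit of \<open>x\<close>, up to an arbitrarily small loss in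
  \<open>q\<close>, because shifting the starting point changes the averages by a null sequence. So it holds
  on a dense \<open>G\<^sub>\<delta>\<close> subset of the orbit closure. A countable uniformly dense set of observables
  and rational \<open>q\<close> suffice to control all observables at once.
\<close>

section \<open>Oscillation of real sequences and Birkhoff averages\<close>

text \<open>Cesaro means of a null sequence: the terms before a threshold contribute a fixed amount, which
  division by \<open>n\<close> makes negligible, and all later terms are below \<open>e / 2\<close>.\<close>

lemma cesaro_tendsto_zero:
  fixes a :: "nat \<Rightarrow> real"
  assumes "a \<longlonglongrightarrow> 0"
  shows "(\<lambda>n. 1 / real (Suc n) * (\<Sum>j<Suc n. a j)) \<longlonglongrightarrow> 0"
proof (rule LIMSEQ_I)
  fix e :: real assume "e > 0"
  then obtain N where N: "\<And>n. n \<ge> N \<Longrightarrow> norm (a n) < e / 2"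
    using LIMSEQ_D[OF assms, of "e / 2"] by auto
  define C where "C = (\<Sum>j<N. \<bar>a j\<bar>)"
  have bound: "\<bar>\<Sum>j<n. a j\<bar> \<le> C + real n * (e / 2)" for n
  proof (induction n)
    case (Suc n)
    show ?case
    proof (cases "n < N")
      case True
      have "\<bar>\<Sum>j<Suc n. a j\<bar> \<le> (\<Sum>j<Suc n. \<bar>a j\<bar>)" by (rule sum_abs)
      also have "\<dots> \<le> C" unfolding C_def using True by (intro sum_mono2) auto
      also have "\<dots> \<le> C + real (Suc n) * (e / 2)" using \<open>e > 0\<close> by simp
      finally show ?thesis .
    next
      case False
      with N[of n] have "\<bar>a n\<bar> \<le> e / 2" by simp
      moreover have "\<bar>\<Sum>j<Suc n. a j\<bar> \<le> \<bar>\<Sum>j<n. a j\<bar> + \<bar>a n\<bar>" by simp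
      moreover have "C + real (Suc n) * (e / 2) = (C + real n * (e / 2)) + e / 2"
        by (simp add: algebra_simps)
      ultimately show ?thesis using Suc.IH by linarith
    qed
  qed (simp add: C_def sum_nonneg)
  have "(\<lambda>n. C * inverse (real (Suc n))) \<longlonglongrightarrow> C * 0"
    by (intro tendsto_intros LIMSEQ_inverse_real_of_nat)
  then have "eventually (\<lambda>n. C * inverse (real (Suc n)) < e / 2) sequentially"
    using \<open>e > 0\<close> by (intro order_tendstoD(2)) auto
  then obtain M where M: "\<And>n. n \<ge> M \<Longrightarrow> C * inverse (real (Suc n)) < e / 2"
    by (auto simp: eventually_sequentially)
  have "norm (1 / real (Suc n) * (\<Sum>j<Suc n. a j) - 0) < e" if "n \<ge> M" for n
  proof -
    have "norm (1 / real (Suc n) * (\<Sum>j<Suc n. a j) - 0) = \<bar>\<Sum>j<Suc n. a j\<bar> / real (Suc n)"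
      by (simp add: abs_mult)
    also have "\<dots> \<le> (C + real (Suc n) * (e / 2)) / real (Suc n)"
      using bound[of "Suc n"] by (rule divide_right_mono) simp
    also have "\<dots> = C * inverse (real (Suc n)) + e / 2"
    proof -
      have "real (Suc n) * (e / 2) / real (Suc n) = e / 2"
        by (rule nonzero_mult_div_cancel_left) simp
      then show ?thesis by (simp only: add_divide_distrib divide_inverse[of C])
    qed
    also have "\<dots> < e" using M[OF that] by simp
    finally show ?thesis .
  qed
  then show "\<exists>M. \<forall>n\<ge>M. norm (1 / real (Suc n) * (\<Sum>j<Suc n. a j) - 0) < e" by blast
qed

text \<open>
  Failure of the Cauchy criterion with an explicit gap. Keeping track of the gap \<open>q\<close> allows
  non-convergence to be transferred between sequences that are merely close to each other.
\<close>

definition oscillates :: "real \<Rightarrow> (nat \<Rightarrow> real) \<Rightarrow> bool" where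
  "oscillates q a \<longleftrightarrow> (\<forall>N. \<exists>m\<ge>N. \<exists>n\<ge>N. q < \<bar>a m - a n\<bar>)"

lemma not_convergent_iff_oscillates:
  "\<not> convergent a \<longleftrightarrow> (\<exists>q>0. oscillates q a)"
proof -
  have "Cauchy a \<longleftrightarrow> (\<forall>q>0. \<not> oscillates q a)"
  proof
    assume "Cauchy a"
    then show "\<forall>q>0. \<not> oscillates q a"
      unfolding oscillates_def Cauchy_def dist_real_def by (metis not_less_iff_gr_or_eq)
  next
    assume *: "\<forall>q>0. \<not> oscillates q a"
    show "Cauchy a"
    proof (rule metric_CauchyI)
      fix e :: real assume "e > 0"
      then have "\<not> oscillates (e / 2) a" using * by simp
      then obtain N where N: "\<And>m n. m \<ge> N \<Longrightarrow> n \<ge> N \<Longrightarrow> \<bar>a m - a n\<bar> \<le> e / 2"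
        unfolding oscillates_def by (auto simp: not_less)
      have "dist (a m) (a n) < e" if "m \<ge> N" "n \<ge> N" for m n
        using N[OF that] \<open>e > 0\<close> by (simp add: dist_real_def)
      then show "\<exists>M. \<forall>m\<ge>M. \<forall>n\<ge>M. dist (a m) (a n) < e" by blast
    qed
  qed
  then show ?thesis by (auto simp: Cauchy_convergent_iff)
qed

lemma oscillates_perturb:
  assumes "oscillates q a" and "eventually (\<lambda>n. \<bar>a n - b n\<bar> \<le> d) sequentially"
  shows "oscillates (q - 2 * d) b"
  unfolding oscillates_def
proof
  fix N
  obtain M where M: "\<And>n. n \<ge> M \<Longrightarrow> \<bar>a n - b n\<bar> \<le> d"
    using assms(2) by (auto simp: eventually_sequentially)
  obtain m n where mn: "m \<ge> max M N" "n \<ge> max M N" "q < \<bar>a m - a n\<bar>"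
    using assms(1) unfolding oscillates_def by meson
  have "q - 2 * d < \<bar>b m - b n\<bar>" using M[of m] M[of n] mn by linarith
  then show "\<exists>m\<ge>N. \<exists>n\<ge>N. q - 2 * d < \<bar>b m - b n\<bar>" using mn by auto
qed

lemma bounded_of_continuous_compact:
  fixes \<phi> :: "'a::topological_space \<Rightarrow> real"
  assumes "compact (UNIV :: 'a set)" "continuous_on UNIV \<phi>"
  obtains C where "C > 0" "\<And>z. \<bar>\<phi> z\<bar> \<le> C"
proof -
  have "bounded (range \<phi>)"
    using assms by (intro compact_imp_bounded compact_continuous_image)
  then show ?thesis using that by (auto simp: bounded_pos)
qed

text \<open>The two sums share all but one term each, so the difference is at most \<open>2 * C / n\<close>. Thus
  irregularity is a property of the orbit and not of its starting point.\<close>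

lemma birkhoff_average_shift_tendsto:
  assumes C: "\<And>z. \<bar>\<phi> z\<bar> \<le> C"
  shows "(\<lambda>n. birkhoff_average T \<phi> (Suc n) z - birkhoff_average T \<phi> (Suc n) (T z)) \<longlonglongrightarrow> 0"
proof (rule Lim_null_comparison)
  show "(\<lambda>n. 2 * C * inverse (real (Suc n))) \<longlonglongrightarrow> 0"
    using tendsto_mult[OF tendsto_const LIMSEQ_inverse_real_of_nat, of "2 * C"] by simp
  show "eventually (\<lambda>n. norm (birkhoff_average T \<phi> (Suc n) z
      - birkhoff_average T \<phi> (Suc n) (T z)) \<le> 2 * C * inverse (real (Suc n))) sequentially"
  proof (intro always_eventually allI)
    fix n
    have "(\<Sum>j<Suc n. \<phi> ((T ^^ j) (T z))) = (\<Sum>j<Suc n. \<phi> ((T ^^ Suc j) z))"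
      by (simp add: funpow_swap1)
    also have "\<dots> = (\<Sum>j<Suc (Suc n). \<phi> ((T ^^ j) z)) - \<phi> z"
      by (subst (2) sum.lessThan_Suc_shift) simp
    also have "\<dots> = (\<Sum>j<Suc n. \<phi> ((T ^^ j) z)) + \<phi> ((T ^^ Suc n) z) - \<phi> z"
      by (simp only: sum.lessThan_Suc[of _ "Suc n"])
    finally have sums: "(\<Sum>j<Suc n. \<phi> ((T ^^ j) (T z))) = \<dots>" .
    have "birkhoff_average T \<phi> (Suc n) z - birkhoff_average T \<phi> (Suc n) (T z)
        = (\<phi> z - \<phi> ((T ^^ Suc n) z)) * inverse (real (Suc n))"
      unfolding birkhoff_average_def sums divide_inverse
      by (simp only: algebra_simps)
    moreover have "\<bar>\<phi> z - \<phi> ((T ^^ Suc n) z)\<bar> \<le> 2 * C"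
      using C[of z] C[of "(T ^^ Suc n) z"] by linarith
    ultimately show "norm (birkhoff_average T \<phi> (Suc n) z
      - birkhoff_average T \<phi> (Suc n) (T z)) \<le> 2 * C * inverse (real (Suc n))"
      by (simp add: abs_mult mult_right_mono del: funpow.simps)
  qed
qed

lemma birkhoff_average_orbit_tendsto:
  assumes C: "\<And>z. \<bar>\<phi> z\<bar> \<le> C"
  shows "(\<lambda>n. birkhoff_average T \<phi> (Suc n) z
    - birkhoff_average T \<phi> (Suc n) ((T ^^ j) z)) \<longlonglongrightarrow> 0"
proof (induction j)
  case (Suc j)
  from tendsto_add[OF Suc birkhoff_average_shift_tendsto[where \<phi> = \<phi> and T = T and z = "(T ^^ j) z", OF C]]
  show ?case by simp
qed simp

lemma birkhoff_average_diff_le: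
  assumes "\<And>z. \<bar>\<phi> z - \<psi> z\<bar> \<le> e"
  shows "\<bar>birkhoff_average T \<phi> (Suc n) z - birkhoff_average T \<psi> (Suc n) z\<bar> \<le> e"
proof -
  have "\<bar>\<Sum>j<Suc n. \<phi> ((T ^^ j) z) - \<psi> ((T ^^ j) z)\<bar> \<le> (\<Sum>j<Suc n. e)"
    by (rule order_trans[OF sum_abs sum_mono]) (rule assms)
  then have "\<bar>(\<Sum>j<Suc n. \<phi> ((T ^^ j) z) - \<psi> ((T ^^ j) z)) / real (Suc n)\<bar> \<le> e"
    by (simp add: divide_le_eq mult.commute del: sum.lessThan_Suc)
  then show ?thesis
    unfolding birkhoff_average_def
    by (simp add: sum_subtractf diff_divide_distrib del: sum.lessThan_Suc)
qed

lemma continuous_on_birkhoff_average: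
  assumes "continuous_on UNIV T" "continuous_on UNIV \<phi>"
  shows "continuous_on UNIV (birkhoff_average T \<phi> n)"
proof -
  have pow: "continuous_on UNIV (T ^^ j)" for j
    by (induction j)
      (auto intro: continuous_on_compose2[OF assms(1)] simp: comp_def)
  have "continuous_on UNIV (\<lambda>z. (1 / real n) * (\<Sum>j<n. \<phi> ((T ^^ j) z)))"
    by (intro continuous_intros continuous_on_compose2[OF assms(2) pow]) auto
  then show ?thesis unfolding birkhoff_average_def[abs_def] .
qed

section \<open>Omega-limit sets and completely irregular points\<close>

lemma omega_limit_iff_closure_tails:
  fixes T :: "'a::metric_space \<Rightarrow> 'a"
  shows "y \<in> omega_limit T x \<longleftrightarrow> (\<forall>N. y \<in> closure ((\<lambda>n. (T ^^ n) x) ` {N..}))"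
proof
  assume "y \<in> omega_limit T x"
  then obtain n where n: "filterlim n at_top sequentially" "(\<lambda>k. (T ^^ n k) x) \<longlonglongrightarrow> y"
    by (auto simp: omega_limit_def)
  show "\<forall>N. y \<in> closure ((\<lambda>n. (T ^^ n) x) ` {N..})"
  proof
    fix N
    have "eventually (\<lambda>k. n k \<ge> N) sequentially"
      using n(1) by (simp add: filterlim_at_top)
    then have "eventually (\<lambda>k. (T ^^ n k) x \<in> closure ((\<lambda>n. (T ^^ n) x) ` {N..})) sequentially"
      by eventually_elim (auto intro!: closure_subset[THEN subsetD])
    then show "y \<in> closure ((\<lambda>n. (T ^^ n) x) ` {N..})"
      by (rule Lim_in_closed_set[OF closed_closure _ _ n(2)]) simp
  qed
next
  assume *: "\<forall>N. y \<in> closure ((\<lambda>n. (T ^^ n) x) ` {N..})"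
  have "\<exists>n\<ge>k. dist ((T ^^ n) x) y < inverse (real (Suc k))" for k
  proof -
    have "inverse (real (Suc k)) > 0" by simp
    then obtain y' where "y' \<in> (\<lambda>n. (T ^^ n) x) ` {k..}" "dist y' y < inverse (real (Suc k))"
      using *[rule_format, of k] unfolding closure_approachable by blast
    then show ?thesis by auto
  qed
  then obtain n where n: "\<And>k. n k \<ge> k" "\<And>k. dist ((T ^^ n k) x) y < inverse (real (Suc k))"
    by metis
  have "filterlim n at_top sequentially"
    using n(1) by (intro filterlim_at_top_mono[OF filterlim_ident]) auto
  moreover have "(\<lambda>k. (T ^^ n k) x) \<longlonglongrightarrow> y"
  proof (subst tendsto_dist_iff, rule Lim_null_comparison[OF _ LIMSEQ_inverse_real_of_nat])
    show "eventually (\<lambda>k. norm (dist ((T ^^ n k) x) y) \<le> inverse (real (Suc k))) sequentially"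
      using n(2) by (auto intro!: always_eventually less_imp_le)
  qed
  ultimately show "y \<in> omega_limit T x" unfolding omega_limit_def by blast
qed

lemma closed_omega_limit: "closed (omega_limit T x)"
  for T :: "'a::metric_space \<Rightarrow> 'a"
proof -
  have "omega_limit T x = (\<Inter>N. closure ((\<lambda>n. (T ^^ n) x) ` {N..}))"
    using omega_limit_iff_closure_tails[of _ T x] by blast
  then show ?thesis by auto
qed

text \<open>A convergent subsequence exists by compactness, and its limit is an \<open>\<omega>\<close>-limit point because the
  times along it tend to infinity.\<close>

lemma subsequence_meets_omega_limit:
  fixes T :: "'a::metric_space \<Rightarrow> 'a"
  assumes "compact (UNIV :: 'a set)" "strict_mono (r :: nat \<Rightarrow> nat)"
  obtains y s where "y \<in> omega_limit T x" "strict_mono s" "(\<lambda>k. (T ^^ r (s k)) x) \<longlonglongrightarrow> y"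
proof -
  obtain y s where s: "strict_mono s" "((\<lambda>k. (T ^^ r k) x) \<circ> s) \<longlonglongrightarrow> y"
    using assms(1)[unfolded compact_def, rule_format, of "\<lambda>k. (T ^^ r k) x"] by auto
  have "strict_mono (r \<circ> s)" using assms(2) s(1) by (rule strict_mono_o)
  then have "filterlim (r \<circ> s) at_top sequentially" by (rule filterlim_subseq)
  then have "y \<in> omega_limit T x"
    using s(2) unfolding omega_limit_def by (auto simp: comp_def)
  then show ?thesis using that s by (auto simp: comp_def)
qed

lemma omega_limit_nonempty:
  fixes T :: "'a::metric_space \<Rightarrow> 'a"
  assumes "compact (UNIV :: 'a set)"
  shows "omega_limit T x \<noteq> {}"
proof -
  obtain y where "y \<in> omega_limit T x"
    using subsequence_meets_omega_limit[OF assms strict_mono_id, of T x] .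
  then show ?thesis by auto
qed

text \<open>By compactness the orbit accumulates only at \<open>\<omega>(x)\<close>: times at which \<open>\<bar>\<phi>\<bar> \<ge> e\<close> would
  accumulate at a point of \<open>\<omega>(x)\<close>, where \<open>\<phi>\<close> vanishes.\<close>

lemma orbit_tendsto_zero_of_vanishing:
  fixes T :: "'a::metric_space \<Rightarrow> 'a" and \<phi> :: "'a \<Rightarrow> real"
  assumes comp: "compact (UNIV :: 'a set)" and cont: "continuous_on UNIV \<phi>"
    and zero: "\<And>z. z \<in> omega_limit T x \<Longrightarrow> \<phi> z = 0"
  shows "(\<lambda>n. \<phi> ((T ^^ n) x)) \<longlonglongrightarrow> 0"
proof (rule tendstoI, rule ccontr)
  fix e :: real assume "e > 0"
    and "\<not> eventually (\<lambda>n. dist (\<phi> ((T ^^ n) x)) 0 < e) sequentially"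
  then obtain r :: "nat \<Rightarrow> nat"
    where r: "strict_mono r" "\<And>n. \<not> dist (\<phi> ((T ^^ r n) x)) 0 < e"
    using not_eventually_sequentiallyD by blast
  obtain y s where y: "y \<in> omega_limit T x" "(\<lambda>k. (T ^^ r (s k)) x) \<longlonglongrightarrow> y"
    using subsequence_meets_omega_limit[OF comp r(1)] by metis
  have "(\<lambda>k. \<phi> ((T ^^ r (s k)) x)) \<longlonglongrightarrow> 0"
    using continuous_on_tendsto_compose[OF cont y(2)] zero[OF y(1)] by simp
  then have "eventually (\<lambda>k. dist (\<phi> ((T ^^ r (s k)) x)) 0 < e) sequentially"
    using \<open>e > 0\<close> by (rule tendstoD)
  then show False using r(2) by simp
qed

lemma completely_irregular_iff:
  "x \<in> completely_irregular T \<longleftrightarrow>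
    irregular_observables T \<noteq> {} \<and> (\<forall>\<phi>\<in>irregular_observables T. x \<in> irregular_set T \<phi>)"
  by (auto simp: completely_irregular_def)

text \<open>Otherwise \<open>\<phi>\<close> would have an irregular point, and then \<open>x\<close> would be irregular for \<open>\<phi>\<close> as well,
  although the averages of \<open>\<phi>\<close> at \<open>x\<close> tend to zero.\<close>

lemma averages_converge_of_vanishing:
  fixes T :: "'a::metric_space \<Rightarrow> 'a" and \<phi> :: "'a \<Rightarrow> real"
  assumes comp: "compact (UNIV :: 'a set)" and x: "x \<in> completely_irregular T"
    and cont: "continuous_on UNIV \<phi>"
    and zero: "\<And>z. z \<in> omega_limit T x \<Longrightarrow> \<phi> z = 0"
  shows "convergent (\<lambda>n. birkhoff_average T \<phi> (Suc n) y)"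
proof (rule ccontr)
  assume "\<not> convergent (\<lambda>n. birkhoff_average T \<phi> (Suc n) y)"
  then have "\<phi> \<in> irregular_observables T"
    using cont by (auto simp: irregular_observables_def irregular_set_def)
  then have "\<not> convergent (\<lambda>n. birkhoff_average T \<phi> (Suc n) x)"
    using x by (auto simp: completely_irregular_iff irregular_set_def)
  moreover have "(\<lambda>n. birkhoff_average T \<phi> (Suc n) x) \<longlonglongrightarrow> 0"
    unfolding birkhoff_average_def
    by (rule cesaro_tendsto_zero[OF orbit_tendsto_zero_of_vanishing[OF comp cont zero]])
  ultimately show False by (auto simp: convergent_def)
qed

text \<open>If the intersection is empty, the distances to the sets \<open>\<omega>(x)\<close> never vanish simultaneously, so
  after normalization they form a partition of unity. It splits an observable into summands
  whose averages converge everywhere.\<close>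

lemma finite_Inter_omega_limit_nonempty:
  fixes T :: "'a::metric_space \<Rightarrow> 'a"
  assumes comp: "compact (UNIV :: 'a set)" and F: "finite F" "F \<subseteq> completely_irregular T"
  shows "(\<Inter>x\<in>F. omega_limit T x) \<noteq> {}"
proof (cases "F = {}")
  case False
  show ?thesis
  proof
    assume empty: "(\<Inter>x\<in>F. omega_limit T x) = {}"
    define g where "g = (\<lambda>x z. infdist z (omega_limit T x))"
    have g_cont: "continuous_on UNIV (g x)" for x
      unfolding g_def by (intro continuous_intros)
    have g_zero: "g x z = 0 \<longleftrightarrow> z \<in> omega_limit T x" for x z
      unfolding g_def
      using in_closed_iff_infdist_zero[OF closed_omega_limit omega_limit_nonempty[OF comp]] by metis
    have g_nonneg: "g x z \<ge> 0" for x z unfolding g_def by (rule infdist_nonneg)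
    define s where "s = (\<lambda>z. \<Sum>x\<in>F. g x z)"
    have s_nz: "s z \<noteq> 0" for z
      using empty by (auto simp: s_def sum_nonneg_eq_0_iff[OF F(1)] g_nonneg g_zero)
    have s_cont: "continuous_on UNIV s" unfolding s_def by (intro continuous_intros g_cont)
    \<comment> \<open>The contradiction arises at any one point of the family, for any irregular observable.\<close>
    obtain x0 where x0: "x0 \<in> F" using False by auto
    then have x0_ci: "x0 \<in> completely_irregular T" using F(2) by auto
    then obtain \<phi> where \<phi>: "\<phi> \<in> irregular_observables T"
      by (auto simp: completely_irregular_iff)
    then have \<phi>_cont: "continuous_on UNIV \<phi>" by (simp add: irregular_observables_def)
    define h where "h = (\<lambda>x z. \<phi> z * (g x z / s z))"
    have "convergent (\<lambda>n. birkhoff_average T (h x) (Suc n) x0)" if "x \<in> F" for x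
    proof (rule averages_converge_of_vanishing[OF comp])
      show "x \<in> completely_irregular T" using that F(2) by auto
      show "continuous_on UNIV (h x)"
        unfolding h_def using s_nz by (intro continuous_intros \<phi>_cont g_cont s_cont) auto
      show "h x z = 0" if "z \<in> omega_limit T x" for z
        using that by (simp add: h_def g_zero[symmetric])
    qed
    then have "convergent (\<lambda>n. \<Sum>x\<in>F. birkhoff_average T (h x) (Suc n) x0)"
      by (rule convergent_sum)
    moreover have "\<phi> z = (\<Sum>x\<in>F. h x z)" for z
    proof -
      have "(\<Sum>x\<in>F. h x z) = \<phi> z * ((\<Sum>x\<in>F. g x z) / s z)"
        by (simp add: h_def sum_distrib_left sum_divide_distrib)
      then have "(\<Sum>x\<in>F. h x z) = \<phi> z * (s z / s z)" by (simp only: s_def)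
      then show ?thesis using s_nz by simp
    qed
    then have "birkhoff_average T \<phi> n z = (\<Sum>x\<in>F. birkhoff_average T (h x) n z)" for n z
      unfolding birkhoff_average_def by (simp add: sum_distrib_left) (rule sum.swap)
    ultimately have "convergent (\<lambda>n. birkhoff_average T \<phi> (Suc n) x0)" by simp
    moreover have "x0 \<in> irregular_set T \<phi>"
      using x0_ci \<phi> by (simp add: completely_irregular_iff)
    ultimately show False by (simp add: irregular_set_def)
  qed
qed simp

section \<open>Limit measures\<close>

text \<open>The empirical measure is the image of the uniform distribution on the times \<open>0, \<dots>, n\<close> under
  \<open>j \<mapsto> T\<^sup>j x\<close>, so the integral becomes a finite sum.\<close>

lemma integral_empirical_measure:
  fixes f :: "'a::topological_space \<Rightarrow> real"
  assumes f: "f \<in> borel_measurable borel"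
  shows "integral\<^sup>L (empirical_measure T x (Suc n)) f = birkhoff_average T f (Suc n) x"
proof -
  define c where "c = ennreal (1 / real (Suc n))"
  have c: "c = 1 / of_nat (Suc n)"
    unfolding c_def by (metis divide_ennreal ennreal_1 ennreal_of_nat_eq_real_of_nat
        of_nat_0_less_iff zero_less_Suc zero_le_one)
  let ?P = "point_measure {..<Suc n} (\<lambda>_. c)"
  let ?g = "\<lambda>j. (T ^^ j) x"
  have g: "?g \<in> measurable ?P borel" by (simp add: measurable_point_measure_eq1)
  have "empirical_measure T x (Suc n) = distr ?P borel ?g"
  proof (rule measure_eqI)
    fix A assume "A \<in> sets (empirical_measure T x (Suc n))"
    then have A: "A \<in> sets borel" by simp
    have "emeasure (distr ?P borel ?g) A = emeasure ?P (?g -` A \<inter> {..<Suc n})"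
      using A g by (simp add: emeasure_distr space_point_measure)
    also have "\<dots> = (\<Sum>j\<in>?g -` A \<inter> {..<Suc n}. c)"
      by (rule emeasure_point_measure_finite) auto
    also have "\<dots> = (\<Sum>j<Suc n. c * indicator A (?g j))"
      by (rule sum.mono_neutral_cong_left) (auto simp: indicator_def)
    also have "\<dots> = c * (\<Sum>j<Suc n. indicator A (?g j))"
      by (simp only: sum_distrib_left)
    finally show "emeasure (empirical_measure T x (Suc n)) A = emeasure (distr ?P borel ?g) A"
      using A by (simp only: emeasure_empirical_measure emeasure_return c)
  qed simp
  then have "integral\<^sup>L (empirical_measure T x (Suc n)) f = integral\<^sup>L ?P (\<lambda>j. f (?g j))"
    using integral_distr[OF g f] by simp
  also have "\<dots> = (\<Sum>j<Suc n. 1 / real (Suc n) * f (?g j))"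
    unfolding c_def by (subst lebesgue_integral_point_measure_finite) simp_all
  finally show ?thesis by (simp add: birkhoff_average_def sum_distrib_left del: sum.lessThan_Suc)
qed

lemma limit_measure_prob:
  assumes "\<mu> \<in> limit_measures T y"
  shows "prob_space \<mu>" "sets \<mu> = sets borel"
  using assms by (auto simp: limit_measures_def borel_prob_measures_def)

lemma limit_measure_integral_eq:
  fixes \<phi> :: "'a::topological_space \<Rightarrow> real"
  assumes \<mu>: "\<mu> \<in> limit_measures T y" and cont: "continuous_on UNIV \<phi>"
    and lim: "(\<lambda>n. birkhoff_average T \<phi> (Suc n) y) \<longlonglongrightarrow> L"
  shows "integral\<^sup>L \<mu> \<phi> = L"
proof -
  obtain r :: "nat \<Rightarrow> nat" where r: "strict_mono r"
    and w: "weak_star_tendsto (\<lambda>k. empirical_measure T y (Suc (r k))) \<mu>"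
    using \<mu> by (auto simp: limit_measures_def)
  have "\<phi> \<in> borel_measurable borel" using cont by (rule borel_measurable_continuous_onI)
  moreover have "(\<lambda>k. integral\<^sup>L (empirical_measure T y (Suc (r k))) \<phi>) \<longlonglongrightarrow> integral\<^sup>L \<mu> \<phi>"
    using w cont unfolding weak_star_tendsto_def by blast
  ultimately have "(\<lambda>k. birkhoff_average T \<phi> (Suc (r k)) y) \<longlonglongrightarrow> integral\<^sup>L \<mu> \<phi>"
    by (simp only: integral_empirical_measure)
  moreover have "(\<lambda>k. birkhoff_average T \<phi> (Suc (r k)) y) \<longlonglongrightarrow> L"
    using LIMSEQ_subseq_LIMSEQ[OF lim r] by (simp add: comp_def)
  ultimately show ?thesis by (rule LIMSEQ_unique)
qed

text \<open>The indicator of \<open>U\<close> is the pointwise limit of the continuous functions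
  \<open>min 1 (k * d(z, - U))\<close>, which vanish outside \<open>U\<close>; dominated convergence applies.\<close>

lemma emeasure_open_eq_of_integrals:
  fixes \<mu> \<nu> :: "'a::metric_space measure"
  assumes \<mu>: "prob_space \<mu>" "sets \<mu> = sets borel" and \<nu>: "prob_space \<nu>" "sets \<nu> = sets borel"
    and U: "open U"
    and eq: "\<And>\<phi> :: 'a \<Rightarrow> real. continuous_on UNIV \<phi> \<Longrightarrow> (\<And>z. z \<notin> U \<Longrightarrow> \<phi> z = 0) \<Longrightarrow>
      integral\<^sup>L \<mu> \<phi> = integral\<^sup>L \<nu> \<phi>"
  shows "emeasure \<mu> U = emeasure \<nu> U"
proof (cases "U = UNIV")
  \<comment> \<open>Here the approximation fails, since the distance to the empty set is by convention zero.\<close>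
  case True
  then show ?thesis
    using prob_space.emeasure_space_1[OF \<mu>(1)] prob_space.emeasure_space_1[OF \<nu>(1)]
      sets_eq_imp_space_eq[OF \<mu>(2)] sets_eq_imp_space_eq[OF \<nu>(2)] by simp
next
  case False
  define f where "f = (\<lambda>k::nat. \<lambda>z. min 1 (real k * infdist z (- U)))"
  have f_cont: "continuous_on UNIV (f k)" for k unfolding f_def by (intro continuous_intros)
  have f_zero: "f k z = 0" if "z \<notin> U" for k z using that by (simp add: f_def)
  have f_lim: "(\<lambda>k. f k z) \<longlonglongrightarrow> indicator U z" for z
  proof (cases "z \<in> U")
    case True
    then have "infdist z (- U) > 0"
      using U False in_closed_iff_infdist_zero[of "- U" z] infdist_nonneg[of z "- U"]
      by (auto simp: less_le)
    then obtain K where K: "1 < real K * infdist z (- U)" using reals_Archimedean3 by blast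
    have "f k z = 1" if "k \<ge> K" for k
    proof -
      have "real K * infdist z (- U) \<le> real k * infdist z (- U)"
        using that by (intro mult_right_mono infdist_nonneg) simp
      then show ?thesis using K by (simp add: f_def)
    qed
    then have "eventually (\<lambda>k. f k z = indicator U z) sequentially"
      using True by (auto simp: eventually_sequentially)
    then show ?thesis by (rule tendsto_eventually)
  qed (simp add: f_zero)
  have lim: "(\<lambda>k. integral\<^sup>L \<kappa> (f k)) \<longlonglongrightarrow> measure \<kappa> U"
    if "prob_space \<kappa>" "sets \<kappa> = sets borel" for \<kappa> :: "'a measure"
  proof -
    interpret prob_space \<kappa> by fact
    have "(\<lambda>k. integral\<^sup>L \<kappa> (f k)) \<longlonglongrightarrow> integral\<^sup>L \<kappa> (indicator U :: 'a \<Rightarrow> real)"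
    proof (rule integral_dominated_convergence[where w = "\<lambda>_. 1"])
      show "f k \<in> borel_measurable \<kappa>" for k
        using borel_measurable_continuous_onI[OF f_cont] measurable_cong_sets[OF that(2) refl] by metis
      show "(indicator U :: 'a \<Rightarrow> real) \<in> borel_measurable \<kappa>"
        using U that(2) by (intro borel_measurable_indicator) simp
      show "AE z in \<kappa>. (\<lambda>k. f k z) \<longlonglongrightarrow> indicator U z" by (simp add: f_lim)
      show "AE z in \<kappa>. norm (f k z) \<le> 1" for k by (simp add: f_def infdist_nonneg)
    qed simp
    then show ?thesis using U that(2) sets_eq_imp_space_eq[OF that(2)] by simp
  qed
  have "integral\<^sup>L \<mu> (f k) = integral\<^sup>L \<nu> (f k)" for k
    by (rule eq[OF f_cont f_zero])
  then have "measure \<mu> U = measure \<nu> U"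
    using lim[OF \<mu>] lim[OF \<nu>] LIMSEQ_unique by auto
  then show ?thesis
    using \<mu>(1) \<nu>(1) by (simp add: finite_measure.emeasure_eq_measure prob_space_def)
qed

lemma limit_measures_agree_off_omega_limit:
  fixes T :: "'a::metric_space \<Rightarrow> 'a"
  assumes comp: "compact (UNIV :: 'a set)" and x: "x \<in> completely_irregular T"
    and \<mu>: "\<mu> \<in> limit_measures T y" and \<nu>: "\<nu> \<in> limit_measures T y"
    and U: "open U" "U \<inter> omega_limit T x = {}"
  shows "emeasure \<mu> U = emeasure \<nu> U"
proof (rule emeasure_open_eq_of_integrals[OF limit_measure_prob[OF \<mu>] limit_measure_prob[OF \<nu>] U(1)])
  fix \<phi> :: "'a \<Rightarrow> real"
  assume cont: "continuous_on UNIV \<phi>" and zero: "\<And>z. z \<notin> U \<Longrightarrow> \<phi> z = 0"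
  have "convergent (\<lambda>n. birkhoff_average T \<phi> (Suc n) y)"
    by (rule averages_converge_of_vanishing[OF comp x cont]) (use zero U(2) in auto)
  then show "integral\<^sup>L \<mu> \<phi> = integral\<^sup>L \<nu> \<phi>"
    using limit_measure_integral_eq[OF \<mu> cont] limit_measure_integral_eq[OF \<nu> cont]
    by (auto simp: convergent_def)
qed

lemma measure_support_off_omega_limit_subset:
  fixes T :: "'a::metric_space \<Rightarrow> 'a"
  assumes comp: "compact (UNIV :: 'a set)" and x: "x \<in> completely_irregular T"
    and \<mu>: "\<mu> \<in> limit_measures T y" and \<nu>: "\<nu> \<in> limit_measures T y"
  shows "measure_support \<mu> \<inter> (UNIV - omega_limit T x) \<subseteq> measure_support \<nu>"
proof
  fix z assume z: "z \<in> measure_support \<mu> \<inter> (UNIV - omega_limit T x)"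
  show "z \<in> measure_support \<nu>"
    unfolding measure_support_def
  proof (intro CollectI allI impI)
    fix W assume W: "open W \<and> z \<in> W"
    let ?U = "W - omega_limit T x"
    have U: "open ?U" using W closed_omega_limit by (auto intro: open_Diff)
    then have "0 < emeasure \<mu> ?U" using z W by (auto simp: measure_support_def)
    also have "\<dots> = emeasure \<nu> ?U"
      by (rule limit_measures_agree_off_omega_limit[OF comp x \<mu> \<nu> U]) auto
    also have "\<dots> \<le> emeasure \<nu> W"
      using W limit_measure_prob(2)[OF \<nu>] by (intro emeasure_mono) auto
    finally show "0 < emeasure \<nu> W" .
  qed
qed

text \<open>Points outside the support have null neighbourhoods, and finitely many of them cover \<open>K\<close>.\<close>

lemma emeasure_compact_disjoint_support:
  assumes sets: "sets \<mu> = sets borel" and K: "compact K" and disj: "measure_support \<mu> \<inter> K = {}"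
  shows "emeasure \<mu> K = 0"
proof -
  have "\<forall>z\<in>K. \<exists>U. open U \<and> z \<in> U \<and> emeasure \<mu> U = 0"
  proof
    fix z assume "z \<in> K"
    then have "z \<notin> measure_support \<mu>" using disj by blast
    then show "\<exists>U. open U \<and> z \<in> U \<and> emeasure \<mu> U = 0"
      unfolding measure_support_def mem_Collect_eq zero_less_iff_neq_zero by blast
  qed
  then obtain U where U: "\<And>z. z \<in> K \<Longrightarrow> open (U z) \<and> z \<in> U z \<and> emeasure \<mu> (U z) = 0"
    by metis
  obtain F where F: "F \<subseteq> K" "finite F" "K \<subseteq> (\<Union>z\<in>F. U z)"
    by (rule compactE_image[OF K, of K U]) (use U in auto)
  have U_null: "U z \<in> null_sets \<mu>" if "z \<in> F" for z
    using U[of z] that F(1) sets by (auto simp: null_sets_def)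
  have "(\<Union>z\<in>F. U z) \<in> null_sets \<mu>"
    by (rule null_sets_UN') (use F(2) U_null countable_finite in auto)
  then show ?thesis
    using F(3) by (metis emeasure_mono le_zero_eq null_setsD1 null_setsD2)
qed

text \<open>Both measures give mass zero to \<open>\<omega>(x)\<close> and coincide on open sets off \<open>\<omega>(x)\<close>, hence on all open
  sets, which form an intersection-stable generator of the Borel sets.\<close>

lemma limit_measure_unique_of_disjoint_support:
  fixes T :: "'a::metric_space \<Rightarrow> 'a"
  assumes comp: "compact (UNIV :: 'a set)" and x: "x \<in> completely_irregular T"
    and \<mu>: "\<mu> \<in> limit_measures T y" "measure_support \<mu> \<inter> omega_limit T x = {}"
    and \<nu>: "\<nu> \<in> limit_measures T y" "measure_support \<nu> \<inter> omega_limit T x = {}"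
  shows "\<mu> = \<nu>"
proof -
  let ?w = "omega_limit T x"
  have K: "compact ?w"
    using compact_Int_closed[OF comp closed_omega_limit] by simp
  have split: "emeasure \<kappa> U = emeasure \<kappa> (U - ?w)"
    if "\<kappa> \<in> limit_measures T y" "measure_support \<kappa> \<inter> ?w = {}" "open U" for \<kappa> U
  proof -
    have "emeasure \<kappa> ?w = 0"
      by (rule emeasure_compact_disjoint_support[OF limit_measure_prob(2)[OF that(1)] K that(2)])
    then have "?w \<in> null_sets \<kappa>"
      using limit_measure_prob(2)[OF that(1)] closed_omega_limit[of T x]
      by (auto simp: null_sets_def)
    then show ?thesis
      using that(3) limit_measure_prob(2)[OF that(1)] by (simp add: emeasure_Diff_null_set)
  qed
  show ?thesis
  proof (rule measure_eqI_generator_eq[where E = "{U. open U}" and \<Omega> = UNIV and A = "\<lambda>_. UNIV"])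
    show "Int_stable {U :: 'a set. open U}" by (auto simp: Int_stable_def)
    show "emeasure \<mu> U = emeasure \<nu> U" if "U \<in> {U. open U}" for U
    proof -
      have U: "open (U - ?w)" using that closed_omega_limit by (auto intro: open_Diff)
      have "emeasure \<mu> (U - ?w) = emeasure \<nu> (U - ?w)"
        by (rule limit_measures_agree_off_omega_limit[OF comp x \<mu>(1) \<nu>(1) U]) auto
      then show ?thesis using split[OF \<mu>] split[OF \<nu>] that by simp
    qed
    show "sets \<mu> = sigma_sets UNIV {U. open U}" "sets \<nu> = sigma_sets UNIV {U. open U}"
      using limit_measure_prob(2)[OF \<mu>(1)] limit_measure_prob(2)[OF \<nu>(1)]
      by (simp_all add: borel_def)
    show "emeasure \<mu> UNIV \<noteq> \<infinity>"
      using limit_measure_prob(1)[OF \<mu>(1)]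
      by (simp add: prob_space_def finite_measure.emeasure_finite)
  qed auto
qed

section \<open>Genericity in the orbit closure\<close>

text \<open>Separability of the space of continuous functions. Tent functions of radius \<open>d n\<close> around the
  points of a finite \<open>d n\<close>-net, normalized to a partition of unity, are combined with rational
  coefficients. By uniform continuity every \<open>\<phi>\<close> is close to such a combination whose coefficients
  approximate the values of \<open>\<phi>\<close> at the net.\<close>

lemma countable_uniformly_dense_continuous:
  assumes comp: "compact (UNIV :: 'a::metric_space set)"
  obtains D :: "('a::metric_space \<Rightarrow> real) set"
  where "countable D" "\<And>f. f \<in> D \<Longrightarrow> continuous_on UNIV f"
    "\<And>\<phi> e. continuous_on UNIV \<phi> \<Longrightarrow> e > 0 \<Longrightarrow> \<exists>f\<in>D. \<forall>z. \<bar>\<phi> z - f z\<bar> \<le> e"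
proof -
  define d where "d = (\<lambda>n. inverse (real (Suc n)))"
  have "\<exists>F::'a set. finite F \<and> UNIV \<subseteq> (\<Union>p\<in>F. ball p (d n))" for n
    using comp unfolding compact_eq_totally_bounded d_def by simp
  then obtain F :: "nat \<Rightarrow> 'a set"
    where F: "\<And>n. finite (F n)" "\<And>n. UNIV \<subseteq> (\<Union>p\<in>F n. ball p (d n))"
    by metis
  define w where "w = (\<lambda>n (p :: 'a) z. max 0 (d n - dist p z))"
  define s where "s = (\<lambda>n z. \<Sum>p\<in>F n. w n p z)"
  have w_nonneg: "w n p z \<ge> 0" for n p z by (simp add: w_def)
  have s_pos: "s n z > 0" for n z
  proof -
    obtain p where "p \<in> F n" "z \<in> ball p (d n)" using F(2)[of n] by blast
    then have "p \<in> F n" "dist p z < d n" by auto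
    then show ?thesis
      unfolding s_def by (intro sum_pos2[OF F(1), of p] w_nonneg) (auto simp: w_def)
  qed
  define comb where "comb = (\<lambda>n (q :: 'a \<Rightarrow> real) z. (\<Sum>p\<in>F n. q p * w n p z) / s n z)"
  define D where "D = (\<Union>n. comb n ` (PiE (F n) (\<lambda>_. \<rat>)))"
  show ?thesis
  proof (rule that)
    show "countable D"
      unfolding D_def
      by (intro countable_UN countable_image countable_PiE F(1) countable_rat) auto
  next
    fix f assume "f \<in> D"
    then obtain n q where f: "f = comb n q" by (auto simp: D_def)
    have "s n z \<noteq> 0" for z using s_pos[of n z] by simp
    then show "continuous_on UNIV f"
      unfolding f comb_def unfolding s_def w_def by (intro continuous_intros) auto
  next
    fix \<phi> :: "'a \<Rightarrow> real" and e :: real assume cont: "continuous_on UNIV \<phi>" and e: "e > 0"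
    have "uniformly_continuous_on UNIV \<phi>" using cont comp by (rule compact_uniformly_continuous)
    then obtain \<delta> where \<delta>: "\<delta> > 0" "\<And>p z. dist p z < \<delta> \<Longrightarrow> dist (\<phi> p) (\<phi> z) < e / 2"
      using e unfolding uniformly_continuous_on_def by (metis UNIV_I half_gt_zero)
    obtain n where n: "d n < \<delta>" using \<delta>(1) reals_Archimedean unfolding d_def by blast
    have "\<exists>r\<in>\<rat>. \<bar>\<phi> p - r\<bar> < e / 2" for p
    proof -
      obtain r where "r \<in> \<rat>" "\<phi> p - e / 2 < r" "r < \<phi> p + e / 2"
        using Rats_dense_in_real[of "\<phi> p - e / 2" "\<phi> p + e / 2"] e by auto
      then show ?thesis by (intro bexI[of _ r] abs_diff_less_iff[THEN iffD2]) auto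
    qed
    then obtain r where r: "\<And>p. r p \<in> \<rat>" "\<And>p. \<bar>\<phi> p - r p\<bar> < e / 2" by metis
    define q where "q = restrict r (F n)"
    have "q \<in> PiE (F n) (\<lambda>_. \<rat>)" by (simp add: q_def r(1))
    then have "comb n q \<in> D" unfolding D_def by (intro UN_I[of n] UNIV_I imageI)
    moreover have "\<bar>\<phi> z - comb n q z\<bar> \<le> e" for z
    proof -
      \<comment> \<open>Only net points within \<open>d n\<close> of \<open>z\<close> carry weight, and there \<open>q p\<close> is close to \<open>\<phi> z\<close>.\<close>
      have "\<bar>\<phi> z - q p\<bar> * w n p z \<le> e * w n p z" if "p \<in> F n" for p
      proof (cases "dist p z < d n")
        case True
        then have "\<bar>\<phi> p - \<phi> z\<bar> < e / 2"
          using \<delta>(2)[of p z] n by (simp add: dist_real_def)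
        moreover have "q p = r p" using that by (simp add: q_def)
        ultimately have "\<bar>\<phi> z - q p\<bar> \<le> e" using r(2)[of p] by linarith
        then show ?thesis by (rule mult_right_mono[OF _ w_nonneg])
      qed (simp add: w_def)
      then have le: "(\<Sum>p\<in>F n. \<bar>\<phi> z - q p\<bar> * w n p z) \<le> e * s n z"
        unfolding s_def sum_distrib_left by (rule sum_mono)
      have "\<phi> z - comb n q z = (\<phi> z * s n z - (\<Sum>p\<in>F n. q p * w n p z)) / s n z"
        using s_pos[of n z] by (simp add: comb_def field_simps)
      also have "\<phi> z * s n z - (\<Sum>p\<in>F n. q p * w n p z) = (\<Sum>p\<in>F n. (\<phi> z - q p) * w n p z)"
        unfolding s_def by (simp add: sum_distrib_left sum_subtractf left_diff_distrib)
      finally have "\<bar>\<phi> z - comb n q z\<bar> = \<bar>\<Sum>p\<in>F n. (\<phi> z - q p) * w n p z\<bar> / s n z"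
        using s_pos[of n z] by simp
      also have "\<dots> \<le> (\<Sum>p\<in>F n. \<bar>\<phi> z - q p\<bar> * w n p z) / s n z"
      proof (rule divide_right_mono)
        show "\<bar>\<Sum>p\<in>F n. (\<phi> z - q p) * w n p z\<bar> \<le> (\<Sum>p\<in>F n. \<bar>\<phi> z - q p\<bar> * w n p z)"
          by (rule order_trans[OF sum_abs]) (simp add: abs_mult w_nonneg)
      qed (use s_pos[of n z] in simp)
      also have "\<dots> \<le> e" using le s_pos[of n z] by (simp add: divide_le_eq)
      finally show ?thesis .
    qed
    ultimately show "\<exists>f\<in>D. \<forall>z. \<bar>\<phi> z - f z\<bar> \<le> e" by blast
  qed
qed

lemma invariant_completely_irregular:
  fixes T :: "'a::topological_space \<Rightarrow> 'a"
  assumes comp: "compact (UNIV :: 'a set)" and x: "x \<in> completely_irregular T"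
  shows "T x \<in> completely_irregular T"
proof -
  have "T x \<in> irregular_set T \<phi>" if \<phi>: "\<phi> \<in> irregular_observables T" for \<phi>
  proof -
    obtain C where C: "\<And>z. \<bar>\<phi> z\<bar> \<le> C"
      using bounded_of_continuous_compact[OF comp, of \<phi>] \<phi> by (auto simp: irregular_observables_def)
    have "\<not> convergent (\<lambda>n. birkhoff_average T \<phi> (Suc n) x)"
      using x \<phi> by (auto simp: completely_irregular_iff irregular_set_def)
    moreover have "convergent (\<lambda>n. birkhoff_average T \<phi> (Suc n) x)"
      if "convergent (\<lambda>n. birkhoff_average T \<phi> (Suc n) (T x))"
      using convergent_add[OF that convergentI[OF
          birkhoff_average_shift_tendsto[where \<phi> = \<phi> and T = T and z = x, OF C]]]
      by simp
    ultimately show ?thesis by (auto simp: irregular_set_def)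
  qed
  then show ?thesis using x by (simp add: completely_irregular_iff)
qed

lemma invariant_closure_orbit:
  assumes "continuous_on UNIV T" "z \<in> closure (orbit T x)"
  shows "T z \<in> closure (orbit T x)"
proof -
  have "T ` orbit T x \<subseteq> orbit T x"
    by (auto simp: orbit_def) (metis funpow.simps(2) comp_apply)
  then have "T ` closure (orbit T x) \<subseteq> closure (orbit T x)"
    using assms(1) closure_subset
    by (intro image_closure_subset) (auto intro: continuous_on_subset)
  then show ?thesis using assms(2) by blast
qed

lemma baire_generic_in_countable_Inter:
  assumes "countable \<U>" and "A \<subseteq> Z" "Z \<inter> \<Inter>\<U> \<subseteq> A"
    and U: "\<And>U. U \<in> \<U> \<Longrightarrow> open U \<and> Z \<subseteq> closure (Z \<inter> U)"
  shows "baire_generic_in A Z"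
proof -
  \<comment> \<open>Adding the whole space makes the family nonempty, so that it can be enumerated.\<close>
  define \<V> where "\<V> = insert UNIV \<U>"
  have \<V>: "range (from_nat_into \<V>) = \<V>"
    unfolding \<V>_def by (rule range_from_nat_into) (use assms(1) in auto)
  have V: "open (from_nat_into \<V> n) \<and> Z \<subseteq> closure (Z \<inter> from_nat_into \<V> n)" for n
  proof -
    have "from_nat_into \<V> n \<in> \<V>" using \<V> by blast
    then have "from_nat_into \<V> n = UNIV \<or> from_nat_into \<V> n \<in> \<U>" by (simp add: \<V>_def)
    then show ?thesis using U closure_subset[of Z] by auto
  qed
  have "(\<Inter>n. Z \<inter> from_nat_into \<V> n) = Z \<inter> \<Inter>\<V>" using \<V> by auto
  then have sub: "(\<Inter>n. Z \<inter> from_nat_into \<V> n) \<subseteq> A" using assms(3) by (simp add: \<V>_def)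
  have od: "openin (top_of_set Z) (Z \<inter> from_nat_into \<V> n) \<and>
      top_of_set Z closure_of (Z \<inter> from_nat_into \<V> n) = Z" for n
  proof
    show "openin (top_of_set Z) (Z \<inter> from_nat_into \<V> n)" using V by (auto intro: openin_open_Int)
    have "top_of_set Z closure_of (Z \<inter> from_nat_into \<V> n)
        = Z \<inter> closure (Z \<inter> from_nat_into \<V> n)"
      by (simp add: closure_of_subtopology Int_assoc[symmetric])
    also have "\<dots> = Z" using V by blast
    finally show "top_of_set Z closure_of (Z \<inter> from_nat_into \<V> n) = Z" .
  qed
  show ?thesis
    unfolding baire_generic_in_def
    by (rule conjI[OF assms(2) exI[of _ "\<lambda>n. Z \<inter> from_nat_into \<V> n"]],
        rule conjI[OF allI[OF od] sub])
qed

text \<open>The averages at \<open>T\<^sup>j x\<close> differ from those at \<open>x\<close> by a null sequence. The strict loss from \<open>q\<close> to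
  \<open>q'\<close> absorbs it for every \<open>j\<close>, with a gap that does not depend on \<open>j\<close>.\<close>

lemma oscillates_along_orbit:
  assumes C: "\<And>z. \<bar>\<phi> z\<bar> \<le> C" and "oscillates q (\<lambda>n. birkhoff_average T \<phi> (Suc n) x)"
    and "q' < q"
  shows "oscillates q' (\<lambda>n. birkhoff_average T \<phi> (Suc n) ((T ^^ j) x))"
proof -
  have "eventually (\<lambda>n. dist (birkhoff_average T \<phi> (Suc n) x
      - birkhoff_average T \<phi> (Suc n) ((T ^^ j) x)) 0 < (q - q') / 2) sequentially"
    using birkhoff_average_orbit_tendsto[OF C] \<open>q' < q\<close> by (intro tendstoD) auto
  then have "eventually (\<lambda>n. \<bar>birkhoff_average T \<phi> (Suc n) x
      - birkhoff_average T \<phi> (Suc n) ((T ^^ j) x)\<bar> \<le> (q - q') / 2) sequentially"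
    by eventually_elim simp
  from oscillates_perturb[OF assms(2) this] show ?thesis by (simp add: field_simps)
qed

text \<open>The sets \<open>W f q N\<close> are open, and those containing the orbit of \<open>x\<close> are dense in its closure.
  Letting \<open>f\<close> range over a countable uniformly dense set and \<open>q\<close> over the rationals leaves
  countably many of them, and a point \<open>z\<close> in all of them is irregular for every observable \<open>\<phi>\<close>
  for which \<open>x\<close> is: approximate \<open>\<phi>\<close> by some \<open>f\<close>, pass from \<open>x\<close> to \<open>z\<close> for \<open>f\<close>, and return to \<open>\<phi>\<close>.\<close>

lemma completely_irregular_generic_in_orbit_closure:
  fixes T :: "'a::metric_space \<Rightarrow> 'a"
  assumes comp: "compact (UNIV :: 'a set)" and T: "continuous_on UNIV T"
    and x: "x \<in> completely_irregular T"
  shows "baire_generic_in (completely_irregular T \<inter> closure (orbit T x)) (closure (orbit T x))"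
proof -
  obtain D :: "('a \<Rightarrow> real) set" where D: "countable D"
    "\<And>f. f \<in> D \<Longrightarrow> continuous_on UNIV f"
    "\<And>\<phi> e. continuous_on UNIV \<phi> \<Longrightarrow> e > 0 \<Longrightarrow> \<exists>f\<in>D. \<forall>z. \<bar>\<phi> z - f z\<bar> \<le> e"
    using countable_uniformly_dense_continuous[OF comp] by metis
  define W where "W = (\<lambda>f q N. {z. \<exists>m\<ge>N. \<exists>n\<ge>N.
    q < \<bar>birkhoff_average T f (Suc m) z - birkhoff_average T f (Suc n) z\<bar>})"
  define P where "P = {(f, q, N). f \<in> D \<and> q \<in> \<rat> \<and> orbit T x \<subseteq> W f q N}"
  define \<U> where "\<U> = (\<lambda>(f, q, N). W f q N) ` P"
  show ?thesis
  proof (rule baire_generic_in_countable_Inter)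
    have "P \<subseteq> D \<times> \<rat> \<times> UNIV" by (auto simp: P_def)
    then have "countable P" by (rule countable_subset) (intro countable_SIGMA D(1) countable_rat, auto)
    then show "countable \<U>" unfolding \<U>_def by (rule countable_image)
  next
    fix U assume "U \<in> \<U>"
    then obtain f q N where U: "U = W f q N" "f \<in> D" "orbit T x \<subseteq> W f q N"
      by (auto simp: \<U>_def P_def)
    have "W f q N = (\<Union>m\<in>{N..}. \<Union>n\<in>{N..}. {z.
        q < \<bar>birkhoff_average T f (Suc m) z - birkhoff_average T f (Suc n) z\<bar>})"
      by (auto simp: W_def)
    also have "open \<dots>"
      using continuous_on_birkhoff_average[OF T D(2)[OF U(2)]]
      by (intro open_UN ballI open_Collect_less continuous_intros)
    finally have "open U" using U(1) by simp
    moreover have "closure (orbit T x) \<subseteq> closure (closure (orbit T x) \<inter> U)"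
      using U closure_subset by (intro closure_mono) auto
    ultimately show "open U \<and> closure (orbit T x) \<subseteq> closure (closure (orbit T x) \<inter> U)" by blast
  next
    show "closure (orbit T x) \<inter> \<Inter>\<U> \<subseteq> completely_irregular T \<inter> closure (orbit T x)"
    proof
      fix z assume z: "z \<in> closure (orbit T x) \<inter> \<Inter>\<U>"
      have "z \<in> irregular_set T \<phi>" if \<phi>: "\<phi> \<in> irregular_observables T" for \<phi>
      proof -
        have cont: "continuous_on UNIV \<phi>" using \<phi> by (simp add: irregular_observables_def)
        have "\<not> convergent (\<lambda>n. birkhoff_average T \<phi> (Suc n) x)"
          using x \<phi> by (auto simp: completely_irregular_iff irregular_set_def)
        then obtain e where e: "e > 0" "oscillates e (\<lambda>n. birkhoff_average T \<phi> (Suc n) x)"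
          unfolding not_convergent_iff_oscillates by blast
        \<comment> \<open>Each exchange of \<open>\<phi>\<close> and \<open>f\<close> costs \<open>e / 4\<close>; a rational \<open>q\<close> strictly between \<open>e / 4\<close>
          and \<open>3 * e / 4\<close> pays for the passage along the orbit and for the return to \<open>\<phi>\<close>.\<close>
        obtain f where f: "f \<in> D" "\<And>z. \<bar>\<phi> z - f z\<bar> \<le> e / 8"
          using D(3)[OF cont, of "e / 8"] e(1) by auto
        have close: "\<bar>birkhoff_average T \<phi> (Suc n) z - birkhoff_average T f (Suc n) z\<bar> \<le> e / 8"
          for n z using f(2) by (rule birkhoff_average_diff_le)
        have f_x: "oscillates (e - 2 * (e / 8)) (\<lambda>n. birkhoff_average T f (Suc n) x)"
          by (rule oscillates_perturb[OF e(2)]) (intro always_eventually allI close)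
        obtain q where q: "q \<in> \<rat>" "e / 4 < q" "q < e - 2 * (e / 8)"
          using Rats_dense_in_real[of "e / 4" "e - 2 * (e / 8)"] e(1) by auto
        obtain C where C: "\<And>z. \<bar>f z\<bar> \<le> C"
          using bounded_of_continuous_compact[OF comp D(2)[OF f(1)]] by blast
        have "orbit T x \<subseteq> W f q N" for N
          using oscillates_along_orbit[OF C f_x q(3)]
          by (auto simp: orbit_def W_def oscillates_def)
        then have "W f q N \<in> \<U>" for N using f(1) q(1) by (force simp: \<U>_def P_def)
        then have "z \<in> W f q N" for N using z by blast
        then have "oscillates q (\<lambda>n. birkhoff_average T f (Suc n) z)"
          by (simp add: W_def oscillates_def)
        then have "oscillates (q - 2 * (e / 8)) (\<lambda>n. birkhoff_average T \<phi> (Suc n) z)"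
          by (rule oscillates_perturb)
            (subst abs_minus_commute, intro always_eventually allI close)
        moreover have "q - 2 * (e / 8) > 0" using q(2) by simp
        ultimately show ?thesis
          unfolding irregular_set_def mem_Collect_eq not_convergent_iff_oscillates by blast
      qed
      then show "z \<in> completely_irregular T \<inter> closure (orbit T x)"
        using z x by (simp add: completely_irregular_iff)
    qed
  qed auto
qed

section \<open>Omega-limits, limit measures and genericity combined\<close>

theorem theorem1:
  fixes T :: "'a::{metric_space, perfect_space} \<Rightarrow> 'a"
  assumes "compact (UNIV :: 'a set)"
    and "continuous_on UNIV T"
  shows "(completely_irregular T \<noteq> {} \<longrightarrow> (\<Inter>x\<in>completely_irregular T. omega_limit T x) \<noteq> {}) \<and>
    (\<forall>x\<in>completely_irregular T. \<forall>y\<in>completely_irregular T.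
      (let S = limit_measures T y -
          {\<mu> \<in> limit_measures T y. measure_support \<mu> \<inter> omega_limit T x \<noteq> {}}
       in finite S \<and> card S \<le> 1)) \<and>
    (\<forall>x\<in>completely_irregular T. \<forall>y\<in>completely_irregular T.
      \<forall>\<mu>\<in>limit_measures T y. \<forall>\<nu>\<in>limit_measures T y.
        measure_support \<mu> \<inter> (UNIV - omega_limit T x) =
        measure_support \<nu> \<inter> (UNIV - omega_limit T x)) \<and>
    (\<forall>x\<in>completely_irregular T.
      \<exists>B. invariant_set T B \<and> B \<subseteq> closure (orbit T x) \<and>
        baire_generic_in B (closure (orbit T x)) \<and>
        x \<in> B \<and> B \<subseteq> completely_irregular T)"
proof (intro conjI)
  note comp = assms(1)
  let ?CI = "completely_irregular T"
  have "UNIV \<inter> (\<Inter>x\<in>?CI. omega_limit T x) \<noteq> {}"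
  proof (rule compact_imp_fip_image[where f = "omega_limit T", OF comp])
    show "closed (omega_limit T x)" for x by (rule closed_omega_limit)
    show "UNIV \<inter> (\<Inter>x\<in>F. omega_limit T x) \<noteq> {}" if "finite F" "F \<subseteq> ?CI" for F
      using finite_Inter_omega_limit_nonempty[OF comp that] by simp
  qed
  then show "?CI \<noteq> {} \<longrightarrow> (\<Inter>x\<in>?CI. omega_limit T x) \<noteq> {}" by simp
  show "\<forall>x\<in>?CI. \<forall>y\<in>?CI.
      (let S = limit_measures T y -
          {\<mu> \<in> limit_measures T y. measure_support \<mu> \<inter> omega_limit T x \<noteq> {}}
       in finite S \<and> card S \<le> 1)"
  proof (intro ballI)
    fix x y assume x: "x \<in> ?CI"
    define S where "S = limit_measures T y -
          {\<mu> \<in> limit_measures T y. measure_support \<mu> \<inter> omega_limit T x \<noteq> {}}"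
    have eq: "\<mu> = \<nu>" if "\<mu> \<in> S" "\<nu> \<in> S" for \<mu> \<nu>
      by (rule limit_measure_unique_of_disjoint_support[OF comp x]) (use that in \<open>auto simp: S_def\<close>)
    have fin: "finite S"
    proof (cases "S = {}")
      case False
      then obtain \<mu> where \<mu>: "\<mu> \<in> S" by blast
      have "S \<subseteq> {\<mu>}" by (intro subsetI, unfold singleton_iff) (intro eq \<mu>)
      then show ?thesis by (rule finite_subset) simp
    qed simp
    have "card S \<le> 1"
      unfolding One_nat_def card_le_Suc0_iff_eq[OF fin] by (intro ballI eq)
    with fin show "let S = limit_measures T y -
          {\<mu> \<in> limit_measures T y. measure_support \<mu> \<inter> omega_limit T x \<noteq> {}}
       in finite S \<and> card S \<le> 1"
      unfolding Let_def S_def[symmetric] by (rule conjI)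
  qed
  show "\<forall>x\<in>?CI. \<forall>y\<in>?CI. \<forall>\<mu>\<in>limit_measures T y. \<forall>\<nu>\<in>limit_measures T y.
        measure_support \<mu> \<inter> (UNIV - omega_limit T x) =
        measure_support \<nu> \<inter> (UNIV - omega_limit T x)"
  proof (intro ballI)
    fix x y \<mu> \<nu>
    assume x: "x \<in> ?CI" and \<mu>: "\<mu> \<in> limit_measures T y" and \<nu>: "\<nu> \<in> limit_measures T y"
    show "measure_support \<mu> \<inter> (UNIV - omega_limit T x) =
        measure_support \<nu> \<inter> (UNIV - omega_limit T x)"
      using measure_support_off_omega_limit_subset[OF comp x \<mu> \<nu>]
        measure_support_off_omega_limit_subset[OF comp x \<nu> \<mu>] by blast
  qed
  show "\<forall>x\<in>?CI. \<exists>B. invariant_set T B \<and> B \<subseteq> closure (orbit T x) \<and>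
        baire_generic_in B (closure (orbit T x)) \<and> x \<in> B \<and> B \<subseteq> ?CI"
  proof
    fix x assume x: "x \<in> ?CI"
    let ?B = "?CI \<inter> closure (orbit T x)"
    have inv: "invariant_set T ?B"
      unfolding invariant_set_def
      by (intro image_subsetI IntI invariant_completely_irregular[OF comp]
          invariant_closure_orbit[OF assms(2)]) simp_all
    have "x = (T ^^ 0) x" by simp
    then have "x \<in> orbit T x" unfolding orbit_def by blast
    then have "x \<in> ?B" using x closure_subset[of "orbit T x"] by auto
    then show "\<exists>B. invariant_set T B \<and> B \<subseteq> closure (orbit T x) \<and>
        baire_generic_in B (closure (orbit T x)) \<and> x \<in> B \<and> B \<subseteq> ?CI"
      by (intro exI[of _ ?B] conjI inv Int_lower1 Int_lower2
          completely_irregular_generic_in_orbit_closure[OF comp assms(2) x])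
  qed
qed

end
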